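(* Let $K$ be a field, let $A$ be a configuration of $K[t_1,\ldots,t_d]$ all of whose monomials have the same total degree $r$ and such that every variable $t_i$ divides at least one monomial of $A$, and for each $1\le i\le d$ let $B_i$ be a configuration of a polynomial ring $K[\mathbf{u}^{(i)}]=K[u^{(i)}_1,\ldots,u^{(i)}_{\mu_i}]$. If the toric rings $K[A], K[B_1],\ldots,K[B_d]$ are all normal, then the toric ring $K[A(B_1,\ldots,B_d)]$ of the nested configuration is normal.
   Context: A configuration of a polynomial ring $K[t_1,\ldots,t_d]$ is a finite set $A=\{\mathbf{t}^{\mathbf{a}_1},\ldots,\mathbf{t}^{\mathbf{a}_n}\}$ of (distinct) monomials such that there is $\mathbf{w}\in\mathbb{R}^d$ with $\mathbf{w}\cdot\mathbf{a}_i=1$ for all $i$. The toric ring $K[A]$ is the $K$-subalgebra generated by the monomials in $A$; it is normal if it is integrally closed in its field of fractions. Nested configuration: write $B_i=\{m^{(i)}_1,\ldots,m^{(i)}_{\lambda_i}\}$, where the polynomial rings $K[\mathbf{u}^{(1)}],\ldots,K[\mathbf{u}^{(d)}]$ have pairwise disjoint sets of variables. Then $$A(B_1,\ldots,B_d)=\{m^{(i_1)}_{j_1}\cdots m^{(i_r)}_{j_r} : t_{i_1}\cdots t_{i_r}\in A,\ 1\le j_k\le\lambda_{i_k}\text{ for }1\le k\le r\},$$ a configuration of $K[\mathbf{u}^{(1)},\ldots,\mathbf{u}^{(d)}]$ (here $t_{i_1}\cdots t_{i_r}$ need not be squarefree). *)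

theory Defs
  imports
    "HOL-Library.Poly_Mapping"
    "HOL-Library.Product_Lexorder"
    "HOL-Computational_Algebra.Polynomial_Factorial"
begin

text \<open>
  A monomial in variables of type \<open>'v\<close> is represented by its exponent vector
  \<open>'v \<Rightarrow>\<^sub>0 nat\<close> (so multiplication of monomials is addition), and polynomials over \<open>'k\<close>
  have type \<open>('v \<Rightarrow>\<^sub>0 nat) \<Rightarrow>\<^sub>0 'k\<close>.  The ring \<open>K[v | v \<in> V]\<close> consists of the polynomials all
  of whose monomials \<open>a\<close> satisfy \<open>keys a \<subseteq> V\<close>.  The linear orders on the types of variables
  have no mathematical content; the library needs them to make the polynomial ring an
  instance of \<open>idom\<close>.
\<close>

definition configuration :: "'v set \<Rightarrow> ('v \<Rightarrow>\<^sub>0 nat) set \<Rightarrow> bool" where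
  "configuration V A \<longleftrightarrow>
     finite A \<and> (\<forall>a\<in>A. Poly_Mapping.keys a \<subseteq> V) \<and>
     (\<exists>w :: 'v \<Rightarrow> real. \<forall>a\<in>A. (\<Sum>v\<in>V. w v * real (Poly_Mapping.lookup a v)) = 1)"

definition total_degree :: "('v \<Rightarrow>\<^sub>0 nat) \<Rightarrow> nat" where
  "total_degree a = (\<Sum>v\<in>Poly_Mapping.keys a. Poly_Mapping.lookup a v)"

inductive_set toric_ring :: "('v \<Rightarrow>\<^sub>0 nat) set \<Rightarrow> (('v \<Rightarrow>\<^sub>0 nat) \<Rightarrow>\<^sub>0 'k::field) set"
  for A :: "('v \<Rightarrow>\<^sub>0 nat) set" where
  const: "Poly_Mapping.single 0 c \<in> toric_ring A"
| monom: "a \<in> A \<Longrightarrow> Poly_Mapping.single a 1 \<in> toric_ring A"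
| add: "p \<in> toric_ring A \<Longrightarrow> q \<in> toric_ring A \<Longrightarrow> p + q \<in> toric_ring A"
| mult: "p \<in> toric_ring A \<Longrightarrow> q \<in> toric_ring A \<Longrightarrow> p * q \<in> toric_ring A"

definition integral_over :: "'a::comm_ring_1 set \<Rightarrow> 'a \<Rightarrow> bool" where
  "integral_over R x \<longleftrightarrow>
     (\<exists>p :: 'a poly. lead_coeff p = 1 \<and> (\<forall>n. coeff p n \<in> R) \<and> poly p x = 0)"

text \<open>
  The field of fractions of a subring \<open>R\<close> of an integral domain is taken inside the fraction
  field \<open>'a fract\<close> of the whole domain, into which \<open>R\<close> embeds by \<open>to_fract\<close>.
\<close>

definition fraction_field :: "'a::idom set \<Rightarrow> 'a fract set" where
  "fraction_field R = {Fract a b | a b. a \<in> R \<and> b \<in> R \<and> b \<noteq> 0}"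

definition normal_ring :: "'a::idom set \<Rightarrow> bool" where
  "normal_ring R \<longleftrightarrow>
     (\<forall>x\<in>fraction_field R. integral_over (to_fract ` R) x \<longrightarrow> x \<in> to_fract ` R)"

text \<open>
  The number \<open>r\<close> of factors is the total degree of the monomial of \<open>A\<close> in question.  Each monomial
  of \<open>A\<close> is written as a product of variables with indices \<open>i 1, \<dots>, i r\<close>, repetitions allowed, and
  each occurrence of a variable may be replaced by a different element of the corresponding \<open>B\<close>.
\<close>

definition nested_configuration ::
  "('t \<Rightarrow>\<^sub>0 nat) set \<Rightarrow> ('t \<Rightarrow> ('v \<Rightarrow>\<^sub>0 nat) set) \<Rightarrow> ('v \<Rightarrow>\<^sub>0 nat) set" where
  "nested_configuration A B =
     {(\<Sum>k\<in>{1..r}. m k) | (r::nat) (i :: nat \<Rightarrow> 't) (m :: nat \<Rightarrow> ('v \<Rightarrow>\<^sub>0 nat)).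
        (\<Sum>k\<in>{1..r}. Poly_Mapping.single (i k) 1) \<in> A \<and> (\<forall>k\<in>{1..r}. m k \<in> B (i k))}"

end

theory Submission
  imports Defs "HOL-Library.Multiset" "HOL-Library.Disjoint_Sets"
begin

text \<open>
  The toric ring of \<open>A\<close> is the semigroup ring of the monoid \<open>S\<close> generated by \<open>A\<close>, and it is normal
  iff \<open>k a = k b + c\<close> with \<open>a, b, c \<in> S\<close> and \<open>k > 0\<close> forces \<open>a - b \<in> S\<close>.  Necessity holds because
  \<open>t\<^sup>a / t\<^sup>b\<close> is a root of \<open>X\<^sup>k - t\<^sup>c\<close>.  For sufficiency, an integral \<open>p / q\<close> is almost integral:
  \<open>c p\<^sup>m \<in> q\<^sup>m K[S]\<close> for a fixed \<open>c \<noteq> 0\<close> and all \<open>m\<close>.  Comparing leading monomials and applying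
  Dickson's lemma to those of the cofactors yields \<open>k lm p = k lm q + s\<close> for some \<open>k > 0\<close>, \<open>s \<in> S\<close>,
  so a monomial multiple of \<open>q\<close> cancels the leading term of \<open>p\<close> without destroying almost
  integrality; this descent terminates with \<open>q\<close> dividing \<open>p\<close> in \<open>K[S]\<close>.

  A vector lies in the monoid of the nested configuration iff its component in the variables of each
  \<open>B i\<close> is a sum of elements of \<open>B i\<close> and the numbers of summands form a vector in the monoid of \<open>A\<close>.
  Since every element of \<open>B i\<close> has weight 1, these numbers depend linearly on the vector, and
  the monoid condition passes from \<open>A\<close> and the \<open>B i\<close> to the nested configuration.
\<close>

subsection \<open>Dickson's lemma\<close>

text \<open>Every sequence in a linear order has a monotone subsequence. A decreasing one of
  naturals attains its minimum and is constant from there on, so its tail is also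
  increasing.\<close>

lemma nat_seq_mono_subseq:
  fixes f :: "nat \<Rightarrow> nat"
  shows "\<exists>\<phi>::nat \<Rightarrow> nat. strict_mono \<phi> \<and> mono (f \<circ> \<phi>)"
proof -
  obtain \<phi> :: "nat \<Rightarrow> nat" where \<phi>: "strict_mono \<phi>" "monoseq (\<lambda>n. f (\<phi> n))"
    using seq_monosub by blast
  show ?thesis
  proof (cases "mono (f \<circ> \<phi>)")
    case True
    with \<phi> show ?thesis by blast
  next
    case False
    then have dec: "f (\<phi> n) \<le> f (\<phi> m)" if "m \<le> n" for m n
      using \<phi>(2) that unfolding monoseq_def mono_def by auto
    obtain n0 where n0: "\<And>n. f (\<phi> n0) \<le> f (\<phi> n)"
      using ex_has_least_nat[of "\<lambda>_. True" 0 "\<lambda>n. f (\<phi> n)"] by auto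
    have "f (\<phi> (n0 + n)) = f (\<phi> n0)" for n
      using dec[of n0 "n0 + n"] n0[of "n0 + n"] by simp
    then have "mono (f \<circ> (\<lambda>n. \<phi> (n0 + n)))"
      by (simp add: mono_def)
    moreover have "strict_mono (\<lambda>n. \<phi> (n0 + n))"
      using \<phi>(1) by (simp add: strict_mono_def)
    ultimately show ?thesis by blast
  qed
qed

text \<open>The subsequence is thinned once for each element of \<open>A\<close>; monotonicity of
  the counts treated earlier survives further thinning.\<close>

lemma mset_seq_mono_subseq:
  fixes M :: "nat \<Rightarrow> 'a multiset"
  assumes "finite A"
  shows "\<exists>\<phi>::nat \<Rightarrow> nat. strict_mono \<phi> \<and> (\<forall>a\<in>A. mono (\<lambda>n. count (M (\<phi> n)) a))"
  using assms
proof (induction A rule: finite_induct)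
  case empty
  show ?case by (intro exI[of _ id]) (simp add: strict_mono_def)
next
  case (insert x A)
  then obtain \<phi> :: "nat \<Rightarrow> nat" where \<phi>: "strict_mono \<phi>" "\<forall>a\<in>A. mono (\<lambda>n. count (M (\<phi> n)) a)"
    by blast
  obtain \<psi> :: "nat \<Rightarrow> nat" where \<psi>: "strict_mono \<psi>" "mono ((\<lambda>n. count (M (\<phi> n)) x) \<circ> \<psi>)"
    using nat_seq_mono_subseq by blast
  have "\<psi> m \<le> \<psi> n" if "m \<le> n" for m n
    using \<psi>(1) that by (simp add: strict_mono_less_eq)
  with \<phi> \<psi> show ?case
    by (intro exI[of _ "\<phi> \<circ> \<psi>"]) (auto simp: strict_mono_def mono_def)
qed

text \<open>A multiset over \<open>A\<close> is a point of a finite power of the naturals. Along a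
  subsequence that is monotone in all coordinates, the first two terms are already
  comparable.\<close>

lemma dickson_mset:
  fixes M :: "nat \<Rightarrow> 'a multiset"
  assumes "finite A" and M: "\<And>n. set_mset (M n) \<subseteq> A"
  obtains i j where "i < j" "M i \<subseteq># M j"
proof -
  obtain \<phi> :: "nat \<Rightarrow> nat" where \<phi>: "strict_mono \<phi>" "\<forall>a\<in>A. mono (\<lambda>n. count (M (\<phi> n)) a)"
    using mset_seq_mono_subseq[OF \<open>finite A\<close>] by blast
  have "count (M (\<phi> 0)) a \<le> count (M (\<phi> 1)) a" for a
  proof (cases "a \<in> A")
    case True
    with \<phi>(2) show ?thesis by (simp add: mono_def)
  next
    case False
    with M[of "\<phi> 0"] have "a \<notin># M (\<phi> 0)" by blast
    then show ?thesis by (simp add: not_in_iff)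
  qed
  then have "M (\<phi> 0) \<subseteq># M (\<phi> 1)" by (simp add: subseteq_mset_def)
  moreover have "\<phi> 0 < \<phi> 1" using \<phi>(1) by (simp add: strict_mono_def)
  ultimately show ?thesis using that by blast
qed

section \<open>Monoids generated by a set and their normality condition\<close>

text \<open>Multisets of generators, rather than an inductive closure, expose the multiplicities to
  which Dickson's lemma applies.\<close>

definition monoid_gen :: "'a::comm_monoid_add set \<Rightarrow> 'a set" where
  "monoid_gen A = {\<Sum>\<^sub># M | M. set_mset M \<subseteq> A}"

lemma monoid_genI: "set_mset M \<subseteq> A \<Longrightarrow> \<Sum>\<^sub># M \<in> monoid_gen A"
  by (auto simp: monoid_gen_def)

lemma monoid_genE:
  assumes "x \<in> monoid_gen A"
  obtains M where "set_mset M \<subseteq> A" "x = \<Sum>\<^sub># M"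
  using assms by (auto simp: monoid_gen_def)

lemma zero_in_monoid_gen: "0 \<in> monoid_gen A"
  using monoid_genI[of "{#}"] by simp

lemma gen_in_monoid_gen: "a \<in> A \<Longrightarrow> a \<in> monoid_gen A"
  using monoid_genI[of "{#a#}"] by simp

lemma add_in_monoid_gen:
  assumes "x \<in> monoid_gen A" "y \<in> monoid_gen A"
  shows "x + y \<in> monoid_gen A"
proof -
  obtain M N where "set_mset M \<subseteq> A" "x = \<Sum>\<^sub># M" "set_mset N \<subseteq> A" "y = \<Sum>\<^sub># N"
    using assms by (elim monoid_genE)
  then show ?thesis using monoid_genI[of "M + N" A] by simp
qed

text \<open>Comparing presentations by generators, and not the elements themselves, makes the
  difference \<open>e\<close> again a sum of generators.\<close>

lemma dickson_monoid_gen: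
  fixes s :: "nat \<Rightarrow> 'a::comm_monoid_add"
  assumes "finite A" "\<And>n. s n \<in> monoid_gen A"
  obtains i j e where "i < j" "e \<in> monoid_gen A" "s j = s i + e"
proof -
  obtain M where M: "\<And>n. set_mset (M n) \<subseteq> A" "\<And>n. s n = \<Sum>\<^sub># (M n)"
    using assms(2) unfolding monoid_gen_def by (simp add: subset_iff) metis
  obtain i j where ij: "i < j" "M i \<subseteq># M j"
    using dickson_mset[OF assms(1), of M] M(1) by blast
  from ij(2) have eq: "M j = M i + (M j - M i)" by simp
  have "set_mset (M j - M i) \<subseteq> A"
    using M(1)[of j] by (meson in_diffD subset_iff)
  moreover have "s j = s i + \<Sum>\<^sub># (M j - M i)"
    unfolding M(2) by (subst eq) (rule sum_mset.union)
  ultimately show ?thesis using that ij(1) monoid_genI by blast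
qed

definition nmul :: "nat \<Rightarrow> 'a::comm_monoid_add \<Rightarrow> 'a" where
  "nmul k x = (\<Sum>i<k. x)"

lemma nmul_0 [simp]: "nmul 0 x = 0"
  and nmul_Suc: "nmul (Suc k) x = nmul k x + x"
  by (simp_all add: nmul_def)

lemma lookup_nmul [simp]:
  fixes x :: "'v \<Rightarrow>\<^sub>0 nat"
  shows "Poly_Mapping.lookup (nmul k x) v = k * Poly_Mapping.lookup x v"
  by (simp add: nmul_def lookup_sum)

lemma single_power: "Poly_Mapping.single x (c::'k::comm_semiring_1) ^ k = Poly_Mapping.single (nmul k x) (c ^ k)"
  by (induction k) (simp_all add: nmul_Suc mult_single algebra_simps)

text \<open>For a cancellative monoid, this is normality without mention of the group of
  differences: if a positive multiple of a difference \<open>a - b\<close> lies in \<open>S\<close>,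
  then so does \<open>a - b\<close>.\<close>

definition normal_monoid :: "'a::comm_monoid_add set \<Rightarrow> bool" where
  "normal_monoid S \<longleftrightarrow>
     (\<forall>a\<in>S. \<forall>b\<in>S. \<forall>c\<in>S. \<forall>k>0. nmul k a = nmul k b + c \<longrightarrow> (\<exists>e\<in>S. a = b + e))"

lemma normal_monoidD:
  assumes "normal_monoid S" "a \<in> S" "b \<in> S" "c \<in> S" "k > 0" "nmul k a = nmul k b + c"
  obtains e where "e \<in> S" "a = b + e"
  using assms unfolding normal_monoid_def by blast

subsection \<open>Toric rings as semigroup rings\<close>

lemma single_in_toric_ring:
  assumes "x \<in> monoid_gen A"
  shows "Poly_Mapping.single x c \<in> toric_ring A"
proof -
  obtain M where M: "set_mset M \<subseteq> A" "x = \<Sum>\<^sub># M"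
    using assms by (rule monoid_genE)
  have "Poly_Mapping.single (\<Sum>\<^sub># M) (1::'b) \<in> toric_ring A" using M(1)
  proof (induction M)
    case empty
    show ?case using toric_ring.const[of 1 A] by simp
  next
    case (add a M)
    then have "Poly_Mapping.single a (1::'b) * Poly_Mapping.single (\<Sum>\<^sub># M) 1 \<in> toric_ring A"
      by (intro toric_ring.mult[OF toric_ring.monom]) auto
    then show ?case by (simp add: mult_single)
  qed
  then have "Poly_Mapping.single 0 c * Poly_Mapping.single x 1 \<in> toric_ring A"
    unfolding M(2) by (intro toric_ring.mult toric_ring.const)
  then show ?thesis by (simp add: mult_single)
qed

lemma poly_mapping_sum_singles:
  "p = (\<Sum>k\<in>Poly_Mapping.keys p. Poly_Mapping.single k (Poly_Mapping.lookup p k))"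
proof (rule poly_mapping_eqI)
  fix k
  show "Poly_Mapping.lookup p k =
      Poly_Mapping.lookup (\<Sum>k\<in>Poly_Mapping.keys p. Poly_Mapping.single k (Poly_Mapping.lookup p k)) k"
    by (auto simp: lookup_sum lookup_single when_def in_keys_iff)
qed

text \<open>Monomials of a product are sums of monomials of the factors, so the right-hand side is
  closed under the ring operations. Conversely, a polynomial is the sum of its terms. Membership
  thus becomes a condition on each monomial separately.\<close>

lemma toric_ring_eq: "toric_ring A = {p. Poly_Mapping.keys p \<subseteq> monoid_gen A}"
proof (intro equalityI subsetI CollectI)
  fix p :: "('a \<Rightarrow>\<^sub>0 nat) \<Rightarrow>\<^sub>0 'b" and x
  assume "p \<in> toric_ring A" and "x \<in> Poly_Mapping.keys p"
  then show "x \<in> monoid_gen A"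
  proof (induction arbitrary: x)
    case (const c)
    then show ?case by (auto intro: zero_in_monoid_gen split: if_splits)
  next
    case (monom a)
    then show ?case by (auto intro: gen_in_monoid_gen)
  next
    case (add p q)
    then show ?case using keys_add[of p q] by blast
  next
    case (mult p q)
    then show ?case using keys_mult[of p q] by (blast intro: add_in_monoid_gen)
  qed
next
  fix p :: "('a \<Rightarrow>\<^sub>0 nat) \<Rightarrow>\<^sub>0 'b"
  assume "p \<in> {p. Poly_Mapping.keys p \<subseteq> monoid_gen A}"
  then have *: "Poly_Mapping.single k (Poly_Mapping.lookup p k) \<in> toric_ring A"
    if "k \<in> Poly_Mapping.keys p" for k
    using that by (auto intro: single_in_toric_ring)
  have "(\<Sum>k\<in>K. Poly_Mapping.single k (Poly_Mapping.lookup p k)) \<in> toric_ring A"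
    if "finite K" "K \<subseteq> Poly_Mapping.keys p" for K
    using that
  proof (induction K rule: finite_induct)
    case empty
    show ?case using toric_ring.const[of 0 A] by simp
  next
    case (insert k K)
    then show ?case by (simp add: toric_ring.add *)
  qed
  then show "p \<in> toric_ring A" by (subst poly_mapping_sum_singles) simp
qed

lemma one_in_toric_ring: "1 \<in> toric_ring A"
  using toric_ring.const[of 1 A] by simp

lemma zero_in_toric_ring: "0 \<in> toric_ring A"
  using toric_ring.const[of 0 A] by simp

lemma uminus_in_toric_ring: "p \<in> toric_ring A \<Longrightarrow> - p \<in> toric_ring A"
  by (simp add: toric_ring_eq)

lemma diff_in_toric_ring: "p \<in> toric_ring A \<Longrightarrow> q \<in> toric_ring A \<Longrightarrow> p - q \<in> toric_ring A"
  by (metis toric_ring.add uminus_in_toric_ring diff_conv_add_uminus)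

lemma power_in_toric_ring: "p \<in> toric_ring A \<Longrightarrow> p ^ n \<in> toric_ring A"
  by (induction n) (auto intro: toric_ring.mult one_in_toric_ring)

lemma sum_in_toric_ring:
  "(\<And>i. i \<in> I \<Longrightarrow> f i \<in> toric_ring A) \<Longrightarrow> sum f I \<in> toric_ring A"
  by (induction I rule: infinite_finite_induct) (auto intro: toric_ring.add zero_in_toric_ring)

lemma to_fract_power: "to_fract (x ^ n) = to_fract x ^ n"
  by (induction n) simp_all

text \<open>The fraction with numerator \<open>t a\<close> and denominator \<open>t b\<close> is
  integral because its \<open>k\<close>-th power is \<open>t c\<close>. Normality makes it a ring
  element \<open>f\<close>, and \<open>t a = f * t b\<close> exhibits \<open>a - b\<close> as a
  monomial of \<open>f\<close>.\<close>

lemma normal_monoid_if_normal_ring: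
  fixes A :: "('v::linorder \<Rightarrow>\<^sub>0 nat) set"
  assumes "normal_ring (toric_ring A :: (('v \<Rightarrow>\<^sub>0 nat) \<Rightarrow>\<^sub>0 'k::field) set)"
  shows "normal_monoid (monoid_gen A)"
  unfolding normal_monoid_def
proof (intro ballI allI impI)
  fix a b c :: "'v \<Rightarrow>\<^sub>0 nat" and k :: nat
  assume abc: "a \<in> monoid_gen A" "b \<in> monoid_gen A" "c \<in> monoid_gen A"
    and k: "0 < k" "nmul k a = nmul k b + c"
  define R where "R = (toric_ring A :: (('v \<Rightarrow>\<^sub>0 nat) \<Rightarrow>\<^sub>0 'k) set)"
  define t where "t x = Poly_Mapping.single x (1::'k)" for x :: "'v \<Rightarrow>\<^sub>0 nat"
  have t: "t x \<in> R" if "x \<in> monoid_gen A" for x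
    using that by (simp add: t_def R_def single_in_toric_ring)
  have t0: "t x \<noteq> 0" for x
    by (simp add: t_def) (metis keys_single keys_zero insert_not_empty zero_neq_one)
  have tpow: "t a ^ k = t c * t b ^ k"
    using k(2) by (simp add: t_def single_power mult_single add.commute)
  define x where "x = Fract (t a) (t b)"
  have "x \<in> fraction_field R"
    using t abc t0 unfolding x_def fraction_field_def by blast
  moreover have "integral_over (to_fract ` R) x"
    unfolding integral_over_def
  proof (intro exI conjI allI)
    let ?P = "Polynomial.monom 1 k - [:to_fract (t c):]"
    \<comment> \<open>As \<open>k > 0\<close>, the constant term does not meet the leading term, so
      \<open>?P\<close> is monic of degree \<open>k\<close>.\<close>
    have co: "coeff ?P n = (if n = k then 1 else if n = 0 then - to_fract (t c) else 0)" for n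
      using k(1) by (auto simp: coeff_pCons split: nat.splits)
    have "degree ?P = k"
    proof (rule antisym)
      show "degree ?P \<le> k" by (rule degree_le) (simp only: co, use k(1) in auto)
      show "k \<le> degree ?P" by (rule le_degree) (simp only: co, simp)
    qed
    then show "lead_coeff ?P = 1" by (simp only: co simp_thms if_True)
    have "1 \<in> R" "0 \<in> R" "- t c \<in> R"
      using t[OF abc(3)] by (auto simp: R_def one_in_toric_ring zero_in_toric_ring uminus_in_toric_ring)
    then show "coeff ?P n \<in> to_fract ` R" for n
      unfolding co by (metis (no_types, lifting) image_eqI to_fract_0 to_fract_1 to_fract_uminus)
    have "x ^ k = to_fract (t c)"
      unfolding x_def Fract_conv_to_fract
      using t0[of b] by (simp add: power_divide divide_eq_eq tpow flip: to_fract_power to_fract_mult)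
    then show "poly ?P x = 0" by (simp add: poly_monom)
  qed
  ultimately obtain f where f: "f \<in> R" "x = to_fract f"
    using assms unfolding normal_ring_def R_def by blast
  then have "to_fract (t a) = to_fract (f * t b)"
    using t0[of b] by (simp add: x_def Fract_conv_to_fract divide_eq_eq)
  then have "t a = f * t b" by (simp only: to_fract_eq_iff)
  then have "a \<in> Poly_Mapping.keys (f * t b)" by (metis t_def keys_single singletonI zero_neq_one)
  then obtain e where "e \<in> Poly_Mapping.keys f" "a = e + b"
    using keys_mult[of f "t b"] by (auto simp: t_def)
  with f(1) show "\<exists>e\<in>monoid_gen A. a = b + e"
    by (auto simp: R_def toric_ring_eq add.commute)
qed

subsection \<open>Normality of semigroup rings\<close>

text \<open>If \<open>N\<close> is the degree of a monic equation for the fraction \<open>x\<close>,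
  then \<open>q ^ N\<close> is a common denominator of all powers of \<open>x\<close>; hence
  \<open>c = q ^ N\<close> works.\<close>

lemma integral_over_imp_almost_integral:
  fixes R :: "'a::idom set"
  assumes sub: "1 \<in> R" "\<And>a b. a \<in> R \<Longrightarrow> b \<in> R \<Longrightarrow> a - b \<in> R" "\<And>a b. a \<in> R \<Longrightarrow> b \<in> R \<Longrightarrow> a * b \<in> R"
    and pq: "p \<in> R" "q \<in> R" "q \<noteq> 0"
    and int: "integral_over (to_fract ` R) (Fract p q)"
  obtains c where "c \<in> R" "c \<noteq> 0" "\<And>m. \<exists>g\<in>R. c * p ^ m = q ^ m * g"
proof -
  have zero: "0 \<in> R" using sub(2)[OF sub(1) sub(1)] by simp
  have add: "a + b \<in> R" if "a \<in> R" "b \<in> R" for a b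
    using sub(2)[OF that(1) sub(2)[OF zero that(2)]] by simp
  have pow: "a ^ n \<in> R" if "a \<in> R" for a n
    using that sub(1,3) by (induction n) auto
  have sum: "(\<Sum>i\<in>I. f i) \<in> R" if "\<And>i. i \<in> I \<Longrightarrow> f i \<in> R" for f :: "nat \<Rightarrow> 'a" and I
    using that by (induction I rule: infinite_finite_induct) (auto intro: zero add)
  define x where "x = Fract p q"
  have xq: "x * to_fract q = to_fract p"
    using pq(3) by (simp add: x_def Fract_conv_to_fract)
  obtain P where P: "lead_coeff P = 1" "\<And>n. coeff P n \<in> to_fract ` R" "poly P x = 0"
    using int unfolding integral_over_def x_def by blast
  define N where "N = degree P"
  obtain a where a: "\<And>n. a n \<in> R" "\<And>n. coeff P n = to_fract (a n)"
    using P(2) unfolding image_iff by metis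
  have "0 = (\<Sum>i\<le>N. coeff P i * x ^ i)"
    using P(3) by (simp add: poly_altdef N_def)
  also have "\<dots> = (\<Sum>i<N. to_fract (a i) * x ^ i) + x ^ N"
    using P(1) a(2) by (simp add: N_def lessThan_Suc_atMost[symmetric])
  finally have xN: "x ^ N = - (\<Sum>i<N. to_fract (a i) * x ^ i)"
    by (simp add: eq_neg_iff_add_eq_0 add.commute)
  \<comment> \<open>For \<open>m < N\<close> the factor \<open>q ^ N\<close> clears the denominator
    of \<open>x ^ m\<close> directly; from \<open>N\<close> on, the monic equation reduces
    \<open>x ^ m\<close> to the \<open>N\<close> preceding powers.\<close>
  have "\<exists>g\<in>R. to_fract (q ^ N) * x ^ m = to_fract g" for m
  proof (induction m rule: less_induct)
    case (less m)
    show ?case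
    proof (cases "m < N")
      case True
      then have "q ^ N = q ^ (N - m) * q ^ m" by (simp flip: power_add)
      then have "to_fract (q ^ N) * x ^ m = to_fract (q ^ (N - m)) * (x * to_fract q) ^ m"
        by (simp add: power_mult_distrib to_fract_power algebra_simps)
      also have "\<dots> = to_fract (q ^ (N - m) * p ^ m)" by (simp add: xq to_fract_power)
      finally show ?thesis using sub(3) pow pq by blast
    next
      case False
      then obtain n where n: "m = n + N" by (metis add.commute le_Suc_ex not_less)
      have "\<exists>g. \<forall>i\<in>{..<N}. g i \<in> R \<and> to_fract (q ^ N) * x ^ (n + i) = to_fract (g i)"
        using less[folded Bex_def] n by (intro bchoice) (simp flip: Bex_def)
      then obtain g where g: "\<And>i. i < N \<Longrightarrow> g i \<in> R"
        "\<And>i. i < N \<Longrightarrow> to_fract (q ^ N) * x ^ (n + i) = to_fract (g i)" by blast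
      have "to_fract (q ^ N) * x ^ m = - (\<Sum>i<N. to_fract (a i) * (to_fract (q ^ N) * x ^ (n + i)))"
        unfolding n power_add xN by (simp add: sum_distrib_left algebra_simps power_add)
      also have "\<dots> = to_fract (0 - (\<Sum>i<N. a i * g i))"
        by (simp add: g(2))
      finally show ?thesis using g(1) a(1) zero sub sum by (metis (no_types, lifting) lessThan_iff)
    qed
  qed note almost = this
  have "\<exists>g\<in>R. q ^ N * p ^ m = q ^ m * g" for m
  proof -
    obtain g where g: "g \<in> R" "to_fract (q ^ N) * x ^ m = to_fract g"
      using almost by blast
    have "to_fract (q ^ N * p ^ m) = to_fract (q ^ N) * (x * to_fract q) ^ m" by (simp add: xq to_fract_power)
    also have "\<dots> = to_fract (q ^ m) * (to_fract (q ^ N) * x ^ m)"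
      by (simp add: to_fract_power power_mult_distrib algebra_simps)
    also have "\<dots> = to_fract (q ^ m * g)" by (simp add: g(2))
    finally show ?thesis using g(1) by (auto simp only: to_fract_eq_iff)
  qed
  with that[of "q ^ N"] pow pq show ?thesis by simp
qed

section \<open>Leading monomials\<close>

abbreviation lm :: "('a::linorder \<Rightarrow>\<^sub>0 'k::zero) \<Rightarrow> 'a" where
  "lm p \<equiv> Max (Poly_Mapping.keys p)"

lemma lm_in_keys: "p \<noteq> 0 \<Longrightarrow> lm p \<in> Poly_Mapping.keys p"
  by (rule Max_in) (auto simp: poly_mapping_eq_iff in_keys_iff fun_eq_iff)

lemma lookup_eq_0_above_lm: "lm p < x \<Longrightarrow> Poly_Mapping.lookup p x = 0"
  by (metis Max_ge finite_keys in_keys_iff not_le)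

lemma lookup_mult_lm:
  fixes p q :: "'a::{linorder, ordered_cancel_comm_monoid_add} \<Rightarrow>\<^sub>0 'k::semiring_0"
  shows "Poly_Mapping.lookup (p * q) (lm p + lm q) =
    Poly_Mapping.lookup p (lm p) * Poly_Mapping.lookup q (lm q)"
proof -
  have "Poly_Mapping.lookup p l * Poly_Mapping.lookup q k = 0"
    if "lm p + lm q = l + k" "l \<noteq> lm p" for l k
  proof (rule ccontr)
    assume "\<not> ?thesis"
    then have "l \<le> lm p" "k \<le> lm q"
      by (metis lookup_eq_0_above_lm mult_zero_left mult_zero_right not_le)+
    with that(2) have "l < lm p" by simp
    then have "l + k < lm p + lm q" using \<open>k \<le> lm q\<close> by (rule add_less_le_mono)
    with that show False by simp
  qed note z = this
  have "Poly_Mapping.lookup (p * q) (lm p + lm q) =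
      (\<Sum>l. Poly_Mapping.lookup p l * (\<Sum>k. Poly_Mapping.lookup q k when lm p + lm q = l + k))"
    by (rule lookup_mult)
  also have "\<dots> = Sum_any (\<lambda>l. Poly_Mapping.lookup p (lm p) * Poly_Mapping.lookup q (lm q) when l = lm p)"
  proof (intro Sum_any.cong)
    fix l
    show "Poly_Mapping.lookup p l * (\<Sum>k. Poly_Mapping.lookup q k when lm p + lm q = l + k) =
      (Poly_Mapping.lookup p (lm p) * Poly_Mapping.lookup q (lm q) when l = lm p)"
    proof (cases "l = lm p")
      case True
      then show ?thesis by (simp add: eq_commute[of "lm q"])
    next
      case False
      show ?thesis
      proof (cases "\<exists>k. lm p + lm q = l + k")
        case True
        then obtain k where k: "lm p + lm q = l + k" by blast
        have "(\<Sum>k'. Poly_Mapping.lookup q k' when lm p + lm q = l + k') = Poly_Mapping.lookup q k"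
          unfolding k by simp
        with z[OF k False] False show ?thesis by simp
      next
        case False2: False
        with False show ?thesis by simp
      qed
    qed
  qed
  also have "\<dots> = Poly_Mapping.lookup p (lm p) * Poly_Mapping.lookup q (lm q)" by simp
  finally show ?thesis .
qed

text \<open>The coefficient at \<open>lm p + lm q\<close> is a product of two nonzero leading
  coefficients, and no sum of monomials of the factors is larger.\<close>

lemma lm_mult:
  fixes p q :: "'a::{linorder, ordered_cancel_comm_monoid_add} \<Rightarrow>\<^sub>0 'k::semiring_no_zero_divisors"
  assumes "p \<noteq> 0" "q \<noteq> 0"
  shows "lm (p * q) = lm p + lm q"
proof (rule Max_eqI)
  show "lm p + lm q \<in> Poly_Mapping.keys (p * q)"
    using lm_in_keys[OF assms(1)] lm_in_keys[OF assms(2)] by (simp add: in_keys_iff lookup_mult_lm)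
  fix y assume "y \<in> Poly_Mapping.keys (p * q)"
  then obtain a b where "y = a + b" "a \<in> Poly_Mapping.keys p" "b \<in> Poly_Mapping.keys q"
    using keys_mult[of p q] by blast
  then show "y \<le> lm p + lm q" by (auto intro: add_mono)
qed simp

lemma lm_power:
  fixes p :: "'a::{linorder, ordered_cancel_comm_monoid_add} \<Rightarrow>\<^sub>0 'k::idom"
  assumes "p \<noteq> 0"
  shows "lm (p ^ n) = nmul n (lm p)"
  using assms by (induction n) (simp_all add: lm_mult nmul_Suc add.commute)

section \<open>Division by descent on the leading monomial\<close>

lemma poly_mapping_nat_nonneg:
  fixes x :: "'v::linorder \<Rightarrow>\<^sub>0 nat"
  shows "0 \<le> x"
proof (rule ccontr)
  assume "\<not> 0 \<le> x"
  then have "x < 0" by simp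
  then show False by (simp add: less_poly_mapping.rep_eq less_fun_def)
qed

text \<open>With infinitely many variables the order on all exponent vectors need not be
  well-founded. In a finitely generated monoid, however, Dickson's lemma finds a later term of the
  chain that is an earlier one plus some \<open>e \<ge> 0\<close>.\<close>

lemma wf_monoid_gen:
  fixes A :: "('v::linorder \<Rightarrow>\<^sub>0 nat) set"
  assumes "finite A"
  shows "wf {(x, y). x < y \<and> x \<in> monoid_gen A}"
proof (rule ccontr)
  assume "\<not> ?thesis"
  then obtain s where s: "\<And>n. s (Suc n) < s n" "\<And>n. s (Suc n) \<in> monoid_gen A"
    unfolding wf_iff_no_infinite_down_chain by auto
  \<comment> \<open>The chain is used from its second term on, since the relation places only the
    smaller element in the monoid.\<close>
  then obtain i j e where ij: "i < j" "s (Suc j) = s (Suc i) + e"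
    using dickson_monoid_gen[OF assms, of "\<lambda>n. s (Suc n)"] by metis
  then have "s (Suc i) \<le> s (Suc j)"
    using add_left_mono[OF poly_mapping_nat_nonneg[of e], of "s (Suc i)"] by simp
  moreover have "s (Suc j) < s (Suc i)" using ij(1) s(1)
    by (induction rule: less_Suc_induct) (auto intro: less_trans)
  ultimately show False by simp
qed

lemma lm_quotient_in_monoid_gen:
  fixes A :: "('v::linorder \<Rightarrow>\<^sub>0 nat) set" and c p q :: "('v \<Rightarrow>\<^sub>0 nat) \<Rightarrow>\<^sub>0 'k::field"
  assumes A: "finite A" "normal_monoid (monoid_gen A)"
    and R: "p \<in> toric_ring A" "q \<in> toric_ring A"
    and nz: "c \<noteq> 0" "p \<noteq> 0" "q \<noteq> 0"
    and almost: "\<And>m. \<exists>g\<in>toric_ring A. c * p ^ m = q ^ m * g"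
  obtains e where "e \<in> monoid_gen A" "lm p = lm q + e"
proof -
  obtain g where g: "\<And>m. g m \<in> toric_ring A" "\<And>m. c * p ^ m = q ^ m * g m"
    using almost by metis
  have g0: "g m \<noteq> 0" for m
    using g(2)[of m] nz by auto
  have gm: "lm (g m) \<in> monoid_gen A" for m
    using g(1)[of m] lm_in_keys[OF g0[of m]] by (auto simp: toric_ring_eq)
  have eq: "lm c + nmul m (lm p) = nmul m (lm q) + lm (g m)" for m
    using arg_cong[OF g(2)[of m], of lm] nz g0[of m] by (simp add: lm_mult lm_power)
  obtain i j s where ij: "i < j" "s \<in> monoid_gen A" "lm (g j) = lm (g i) + s"
    using dickson_monoid_gen[OF A(1), of "\<lambda>m. lm (g m)"] gm by metis
  obtain k where k: "k > 0" "j = i + k" using less_imp_add_positive[OF ij(1)] by auto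
  \<comment> \<open>Subtracting equation \<open>i\<close> from equation \<open>j\<close> cancels
    both the unknown \<open>lm c\<close> and \<open>lm (g i)\<close>.\<close>
  have "nmul k (lm p) = nmul k (lm q) + s"
  proof (rule poly_mapping_eqI)
    fix v
    show "Poly_Mapping.lookup (nmul k (lm p)) v = Poly_Mapping.lookup (nmul k (lm q) + s) v"
      using arg_cong[OF eq[of i], of "\<lambda>x. Poly_Mapping.lookup x v"]
        arg_cong[OF eq[of j], of "\<lambda>x. Poly_Mapping.lookup x v"]
      by (simp add: lookup_add ij(3) flip: k(2)) (simp add: k(2) algebra_simps)
  qed
  moreover have "lm p \<in> monoid_gen A" "lm q \<in> monoid_gen A"
    using R lm_in_keys nz by (auto simp: toric_ring_eq)
  ultimately show ?thesis
    using normal_monoidD[OF A(2) _ _ ij(2) k(1)] that by blast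
qed

text \<open>This is long division by \<open>q\<close>: the leading term of \<open>p\<close> is
  removed by a multiple of \<open>q\<close> with cofactor in the ring, and the remainder satisfies
  the hypothesis with the same \<open>c\<close>, so the division can continue.\<close>

lemma almost_integral_imp_dvd:
  fixes A :: "('v::linorder \<Rightarrow>\<^sub>0 nat) set" and c p q :: "('v \<Rightarrow>\<^sub>0 nat) \<Rightarrow>\<^sub>0 'k::field"
  assumes A: "finite A" "normal_monoid (monoid_gen A)"
    and c: "c \<noteq> 0" and q: "q \<in> toric_ring A" "q \<noteq> 0"
    and p: "p \<in> toric_ring A" "\<And>m. \<exists>g\<in>toric_ring A. c * p ^ m = q ^ m * g"
  shows "\<exists>h\<in>toric_ring A. p = h * q"
  using p
proof (induction "lm p" arbitrary: p rule: wf_induct_rule[OF wf_monoid_gen[OF A(1)]])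
  case 1
  show ?case
  proof (cases "p = 0")
    case True
    then show ?thesis using zero_in_toric_ring by (intro bexI[of _ 0]) auto
  next
    case False
    obtain e where e: "e \<in> monoid_gen A" "lm p = lm q + e"
      using lm_quotient_in_monoid_gen[OF A "1.prems"(1) q(1) c False q(2) "1.prems"(2)] by blast
    \<comment> \<open>The coefficient is chosen so that \<open>t * q\<close> has the same leading
      term as \<open>p\<close>.\<close>
    define t where "t = Poly_Mapping.single e (Poly_Mapping.lookup p (lm p) / Poly_Mapping.lookup q (lm q))"
    have t: "t \<in> toric_ring A"
      unfolding t_def by (rule single_in_toric_ring[OF e(1)])
    define p' where "p' = p - t * q"
    have p': "p' \<in> toric_ring A"
      unfolding p'_def by (intro diff_in_toric_ring toric_ring.mult "1.prems" t q)
    have "Poly_Mapping.lookup p (lm p) \<noteq> 0" "Poly_Mapping.lookup q (lm q) \<noteq> 0"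
      using lm_in_keys False q(2) by (auto simp: in_keys_iff)
    then have lt: "lm t = e" "t \<noteq> 0" "Poly_Mapping.lookup t e * Poly_Mapping.lookup q (lm q) = Poly_Mapping.lookup p (lm p)"
      by (auto simp: t_def single_zero) (metis divide_eq_0_iff keys_single keys_zero insert_not_empty)
    have lmp: "lm (t * q) = lm p"
      using lm_mult[OF lt(2) q(2)] lt(1) e(2) by (simp add: add.commute)
    \<comment> \<open>In the binomial expansion, \<open>c * p ^ i\<close> contributes a factor
      \<open>q ^ i\<close> and \<open>((- t) * q) ^ (m - i)\<close> the remaining
      \<open>q ^ (m - i)\<close>, so \<open>q ^ m\<close> factors out of every term.\<close>
    have almost: "\<exists>g\<in>toric_ring A. c * p' ^ m = q ^ m * g" for m
    proof -
      obtain g where g: "\<And>m. g m \<in> toric_ring A" "\<And>m. c * p ^ m = q ^ m * g m"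
        using "1.prems"(2) by metis
      have "c * p' ^ m = c * (p + (- t) * q) ^ m" by (simp add: p'_def)
      also have "\<dots> = (\<Sum>i\<le>m. of_nat (m choose i) * (c * p ^ i) * ((- t) * q) ^ (m - i))"
        unfolding binomial_ring by (simp add: sum_distrib_left algebra_simps)
      also have "\<dots> = (\<Sum>i\<le>m. q ^ m * (of_nat (m choose i) * g i * (- t) ^ (m - i)))"
      proof (rule sum.cong)
        fix i assume "i \<in> {..m}"
        then have "q ^ m = q ^ i * q ^ (m - i)" by (simp flip: power_add)
        then show "of_nat (m choose i) * (c * p ^ i) * ((- t) * q) ^ (m - i) =
            q ^ m * (of_nat (m choose i) * g i * (- t) ^ (m - i))"
          unfolding g(2) power_mult_distrib by (simp only: mult_ac)
      qed simp
      also have "\<dots> = q ^ m * (\<Sum>i\<le>m. of_nat (m choose i) * g i * (- t) ^ (m - i))"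
        by (simp add: sum_distrib_left)
      finally have "c * p' ^ m = q ^ m * (\<Sum>i\<le>m. of_nat (m choose i) * g i * (- t) ^ (m - i))" .
      moreover have "of_nat n \<in> toric_ring A" for n
        using toric_ring.const[of "of_nat n" A] by simp
      then have "(\<Sum>i\<le>m. of_nat (m choose i) * g i * (- t) ^ (m - i)) \<in> toric_ring A"
        by (intro sum_in_toric_ring toric_ring.mult power_in_toric_ring uminus_in_toric_ring g(1) t) auto
      ultimately show ?thesis by blast
    qed
    have "\<exists>h\<in>toric_ring A. p' = h * q"
    proof (cases "p' = 0")
      case True
      then show ?thesis using zero_in_toric_ring by (intro bexI[of _ 0]) auto
    next
      case nz: False
      have "lm p' \<in> Poly_Mapping.keys p'" by (rule lm_in_keys[OF nz])
      moreover have "Poly_Mapping.lookup p' (lm p) = 0"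
        using lookup_mult_lm[of t q] lt(1,3) e(2) by (simp add: p'_def lookup_minus add.commute)
      moreover have "lm p' \<le> lm p"
      proof (rule ccontr)
        assume "\<not> ?thesis"
        then have "Poly_Mapping.lookup p' (lm p') = 0"
          using lmp by (simp add: p'_def lookup_minus lookup_eq_0_above_lm)
        then show False using lm_in_keys[OF nz] by (simp add: in_keys_iff)
      qed
      ultimately have "lm p' < lm p" by (metis in_keys_iff order_le_less)
      moreover have "lm p' \<in> monoid_gen A"
        using p' lm_in_keys[OF nz] by (auto simp: toric_ring_eq)
      ultimately show ?thesis using "1.hyps"[of p'] p' almost by blast
    qed
    then obtain h where "h \<in> toric_ring A" "p' = h * q" by blast
    then have "h + t \<in> toric_ring A" "p = (h + t) * q"
      using t by (auto simp: p'_def algebra_simps intro: toric_ring.add)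
    then show ?thesis by blast
  qed
qed

lemma normal_ring_if_normal_monoid:
  fixes A :: "('v::linorder \<Rightarrow>\<^sub>0 nat) set"
  assumes A: "finite A" "normal_monoid (monoid_gen A)"
  shows "normal_ring (toric_ring A :: (('v \<Rightarrow>\<^sub>0 nat) \<Rightarrow>\<^sub>0 'k::field) set)"
  unfolding normal_ring_def
proof (intro ballI impI)
  fix x :: "(('v \<Rightarrow>\<^sub>0 nat) \<Rightarrow>\<^sub>0 'k) fract"
  assume "x \<in> fraction_field (toric_ring A)" and int: "integral_over (to_fract ` toric_ring A) x"
  then obtain p q where pq: "x = Fract p q" "p \<in> toric_ring A" "q \<in> toric_ring A" "q \<noteq> 0"
    unfolding fraction_field_def by blast
  obtain c where "c \<noteq> 0" "\<And>m. \<exists>g\<in>toric_ring A. c * p ^ m = q ^ m * g"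
    using integral_over_imp_almost_integral[OF one_in_toric_ring diff_in_toric_ring toric_ring.mult pq(2-4)]
      int unfolding pq(1) by blast
  then obtain h where h: "h \<in> toric_ring A" "p = h * q"
    using almost_integral_imp_dvd[OF A _ pq(3,4,2)] by blast
  then have "x = to_fract h" using pq(4) by (simp add: pq(1) Fract_conv_to_fract)
  with h(1) show "x \<in> to_fract ` toric_ring A" by blast
qed

subsection \<open>Nested configurations\<close>

text \<open>A pair \<open>(i, b)\<close> stands for one occurrence of the variable with index
  \<open>i\<close>, replaced by \<open>b\<close>. Forgetting the replacements leaves the monomial
  that was substituted into.\<close>

abbreviation index_sum :: "('t \<times> 'a) multiset \<Rightarrow> 't \<Rightarrow>\<^sub>0 nat" where
  "index_sum Z \<equiv> (\<Sum>z\<in>#Z. Poly_Mapping.single (fst z) 1)"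

lemma lookup_index_sum: "Poly_Mapping.lookup (index_sum Z) i = count (image_mset fst Z) i"
  by (induction Z) (auto simp: lookup_add lookup_single when_def)

lemma sum_nth_eq_sum_mset:
  "(\<Sum>k\<in>{1..length zs}. f (zs ! (k - 1))) = (\<Sum>z\<in>#mset zs. f z)"
proof -
  have "(\<Sum>k\<in>{1..length zs}. f (zs ! (k - 1))) = (\<Sum>k<length zs. f (zs ! k))"
    by (rule sum.reindex_bij_witness[of _ Suc "\<lambda>k. k - 1"]) auto
  also have "\<dots> = (\<Sum>z\<in>#mset zs. f z)"
    by (simp add: sum_mset_sum_list sum_list_sum_nth atLeast0LessThan flip: mset_map)
  finally show ?thesis .
qed

text \<open>The order of the factors is immaterial, so the families \<open>i\<close> and
  \<open>m\<close> amount to one multiset of pairs.\<close>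

lemma nested_configuration_eq:
  "nested_configuration A B =
     {\<Sum>\<^sub># (image_mset snd Z) | Z. index_sum Z \<in> A \<and> (\<forall>z\<in>#Z. snd z \<in> B (fst z))}"
proof (intro equalityI subsetI)
  fix x assume "x \<in> nested_configuration A B"
  then obtain r i m where *: "x = (\<Sum>k\<in>{1..r::nat}. m k)"
    "(\<Sum>k\<in>{1..r}. Poly_Mapping.single (i k) 1) \<in> A" "\<forall>k\<in>{1..r}. m k \<in> B (i k)"
    unfolding nested_configuration_def by blast
  define Z where "Z = image_mset (\<lambda>k. (i k, m k)) (mset_set {1..r})"
  have "x = \<Sum>\<^sub># (image_mset snd Z)" "index_sum Z \<in> A" "\<forall>z\<in>#Z. snd z \<in> B (fst z)"
    using * by (auto simp: Z_def sum_unfold_sum_mset image_mset.compositionality comp_def)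
  then show "x \<in> {\<Sum>\<^sub># (image_mset snd Z) | Z. index_sum Z \<in> A \<and> (\<forall>z\<in>#Z. snd z \<in> B (fst z))}"
    by blast
next
  fix x
  assume "x \<in> {\<Sum>\<^sub># (image_mset snd Z) | Z. index_sum Z \<in> A \<and> (\<forall>z\<in>#Z. snd z \<in> B (fst z))}"
  then obtain Z where Z: "x = \<Sum>\<^sub># (image_mset snd Z)" "index_sum Z \<in> A"
    "\<forall>z\<in>#Z. snd z \<in> B (fst z)" by blast
  obtain zs where zs: "mset zs = Z" using ex_mset by blast
  have "x = (\<Sum>k\<in>{1..length zs}. snd (zs ! (k - 1)))"
    by (simp only: sum_nth_eq_sum_mset zs Z(1))
  moreover have "(\<Sum>k\<in>{1..length zs}. Poly_Mapping.single (fst (zs ! (k - 1))) 1) \<in> A"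
    using Z(2) by (simp only: sum_nth_eq_sum_mset[of "\<lambda>z. Poly_Mapping.single (fst z) 1"] zs)
  moreover have "\<forall>k\<in>{1..length zs}. snd (zs ! (k - 1)) \<in> B (fst (zs ! (k - 1)))"
    using Z(3) by (auto simp: zs[symmetric])
  ultimately show "x \<in> nested_configuration A B"
    unfolding nested_configuration_def by (intro CollectI exI conjI)
qed

text \<open>Exponent vectors are read as multisets of indices; a splitting of the image of
  \<open>Z\<close> under \<open>fst\<close> lifts to a splitting of \<open>Z\<close>.\<close>

lemma index_sum_eq_addD:
  assumes "index_sum Z = a + b"
  obtains Z1 Z2 where "Z = Z1 + Z2" "index_sum Z1 = a" "index_sum Z2 = b"
proof -
  define X where "X c = Abs_multiset (Poly_Mapping.lookup c)" for c :: "'a \<Rightarrow>\<^sub>0 nat"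
  have X: "count (X c) i = Poly_Mapping.lookup c i" for c i
    unfolding X_def by (subst Abs_multiset_inverse) (simp_all add: finite_lookup)
  have "image_mset fst Z = X a + X b"
    using arg_cong[OF assms, of "\<lambda>c. Poly_Mapping.lookup c _"]
    by (intro multiset_eqI) (simp only: lookup_index_sum lookup_add count_union X)
  then obtain Z1 Z2 where Z: "Z = Z1 + Z2" "X a = image_mset fst Z1" "X b = image_mset fst Z2"
    by (blast dest: image_mset_eq_plusD)
  show ?thesis
    by (rule that[OF Z(1)]; rule poly_mapping_eqI)
       (simp_all only: lookup_index_sum X flip: Z(2,3))
qed

text \<open>If the index monomial of \<open>Z\<close> is a product of monomials of \<open>A\<close>,
  then \<open>Z\<close> splits into one block per factor, and each block sums to a nested generator.
  Conversely, such blocks are merged.\<close>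

lemma monoid_gen_nested_configuration:
  "monoid_gen (nested_configuration A B) =
     {\<Sum>\<^sub># (image_mset snd Z) | Z. index_sum Z \<in> monoid_gen A \<and> (\<forall>z\<in>#Z. snd z \<in> B (fst z))}"
  (is "_ = ?R")
proof (intro equalityI subsetI)
  fix x assume "x \<in> monoid_gen (nested_configuration A B)"
  then obtain M where M: "set_mset M \<subseteq> nested_configuration A B" "x = \<Sum>\<^sub># M"
    by (rule monoid_genE)
  have "\<Sum>\<^sub># M \<in> ?R" using M(1)
  proof (induction M)
    case empty
    show ?case by (intro CollectI exI[of _ "{#}"]) (simp add: zero_in_monoid_gen)
  next
    case (add a M)
    then obtain Z1 Z2 where
      Z1: "a = \<Sum>\<^sub># (image_mset snd Z1)" "index_sum Z1 \<in> A" "\<forall>z\<in>#Z1. snd z \<in> B (fst z)" and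
      Z2: "\<Sum>\<^sub># M = \<Sum>\<^sub># (image_mset snd Z2)" "index_sum Z2 \<in> monoid_gen A" "\<forall>z\<in>#Z2. snd z \<in> B (fst z)"
      unfolding nested_configuration_eq by auto
    show ?case
      using Z1 Z2 by (intro CollectI exI[of _ "Z1 + Z2"])
        (auto intro: add_in_monoid_gen gen_in_monoid_gen)
  qed
  with M(2) show "x \<in> ?R" by simp
next
  fix x assume "x \<in> ?R"
  then obtain Z where Z: "x = \<Sum>\<^sub># (image_mset snd Z)" "index_sum Z \<in> monoid_gen A"
    "\<forall>z\<in>#Z. snd z \<in> B (fst z)" by blast
  obtain M where "set_mset M \<subseteq> A" "index_sum Z = \<Sum>\<^sub># M"
    using Z(2) by (rule monoid_genE)
  then have "\<Sum>\<^sub># (image_mset snd Z) \<in> monoid_gen (nested_configuration A B)" using Z(3)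
  proof (induction M arbitrary: Z)
    case empty
    have "count (image_mset fst Z) i = 0" for i
      using empty.prems(2) by (simp only: flip: lookup_index_sum) simp
    then have "image_mset fst Z = {#}" by (intro multiset_eqI) simp
    then have "Z = {#}" by simp
    then show ?case by (simp add: zero_in_monoid_gen)
  next
    case (add a M)
    from add.prems(2) obtain Z1 Z2 where Z12: "Z = Z1 + Z2" "index_sum Z1 = a" "index_sum Z2 = \<Sum>\<^sub># M"
      using index_sum_eq_addD[of Z a "\<Sum>\<^sub># M"] by auto
    have "\<Sum>\<^sub># (image_mset snd Z1) \<in> nested_configuration A B"
      unfolding nested_configuration_eq using Z12 add.prems by auto
    moreover have "\<Sum>\<^sub># (image_mset snd Z2) \<in> monoid_gen (nested_configuration A B)"
      using Z12 add.prems by (intro add.IH) auto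
    ultimately show ?case by (simp add: Z12(1) gen_in_monoid_gen add_in_monoid_gen)
  qed
  with Z(1) show "x \<in> monoid_gen (nested_configuration A B)" by simp
qed

text \<open>The size of \<open>Z\<close> is the total degree of its index monomial, hence bounded
  over the finite set \<open>A\<close>, and its pairs come from a finite set.\<close>

lemma finite_nested_configuration:
  assumes A: "finite A" and keys: "\<And>a. a \<in> A \<Longrightarrow> Poly_Mapping.keys a \<subseteq> D" 
    and B: "finite D" "\<And>i. i \<in> D \<Longrightarrow> finite (B i)"
  shows "finite (nested_configuration A B)"
proof -
  have "finite {Z. (index_sum Z :: 'a \<Rightarrow>\<^sub>0 nat) \<in> A \<and> (\<forall>z\<in>#Z. snd z \<in> B (fst z))}" (is "finite ?Z")
  proof -
    \<comment> \<open>The inserted 0 keeps the maximum defined when \<open>A\<close> is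
      empty.\<close>
    define n where "n = Max (insert 0 ((\<lambda>a. \<Sum>i\<in>D. Poly_Mapping.lookup a i) ` A))"
    have "?Z \<subseteq> {Z. set_mset Z \<subseteq> Sigma D B \<and> size Z \<le> n}"
    proof (intro subsetI CollectI)
      fix Z assume Z: "Z \<in> ?Z"
      have fst: "fst z \<in> D" if "z \<in># Z" for z
      proof -
        have "fst z \<in># image_mset fst Z" using that by simp
        then have "fst z \<in> Poly_Mapping.keys (index_sum Z)"
          by (simp only: in_keys_iff lookup_index_sum) simp
        then show ?thesis using keys Z by blast
      qed
      have "size Z = size (image_mset fst Z)" by simp
      also have "\<dots> = (\<Sum>i\<in>D. count (image_mset fst Z) i)"
        unfolding size_multiset_overloaded_eq
        by (rule sum.mono_neutral_left) (use B(1) fst in \<open>auto simp: count_eq_zero_iff\<close>)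
      also have "\<dots> = (\<Sum>i\<in>D. Poly_Mapping.lookup (index_sum Z) i)"
        by (simp only: lookup_index_sum)
      also have "\<dots> \<le> n"
        unfolding n_def using A Z by (intro Max_ge) auto
      finally show "set_mset Z \<subseteq> Sigma D B \<and> size Z \<le> n"
        using fst Z by auto
    qed
    moreover have "finite {Z. set_mset Z \<subseteq> Sigma D B \<and> size Z \<le> n}"
    proof (rule finite_subset)
      show "{Z. set_mset Z \<subseteq> Sigma D B \<and> size Z \<le> n} \<subseteq>
          mset ` {zs. set zs \<subseteq> Sigma D B \<and> length zs \<le> n}"
      proof
        fix Z assume "Z \<in> {Z. set_mset Z \<subseteq> Sigma D B \<and> size Z \<le> n}"
        moreover obtain zs where "mset zs = Z" using ex_mset by blast
        ultimately show "Z \<in> mset ` {zs. set zs \<subseteq> Sigma D B \<and> length zs \<le> n}"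
          by (intro image_eqI[of _ _ zs]) auto
      qed
      show "finite (mset ` {zs. set zs \<subseteq> Sigma D B \<and> length zs \<le> n})"
        using B by (intro finite_imageI finite_lists_length_le finite_SigmaI)
    qed
    ultimately show ?thesis by (rule finite_subset)
  qed
  then have "finite ((\<lambda>Z. \<Sum>\<^sub># (image_mset snd Z)) ` ?Z)" by (rule finite_imageI)
  then show ?thesis unfolding nested_configuration_eq by (simp add: setcompr_eq_image)
qed

text \<open>The relation splits into one relation per block of variables, and weights turn these
  into a relation between numbers of summands. Normality of each \<open>B i\<close> yields the
  difference within a block, normality of \<open>A\<close> the difference of the numbers, and
  weights show that the two fit together.\<close>

lemma normal_monoid_nested_configuration:
  fixes A :: "('t \<Rightarrow>\<^sub>0 nat) set" and B :: "'t \<Rightarrow> ('v \<Rightarrow>\<^sub>0 nat) set"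
  assumes D: "finite D" "\<And>a. a \<in> A \<Longrightarrow> Poly_Mapping.keys a \<subseteq> D"
    and V: "disjoint_family_on V D"
    and B: "\<And>i. i \<in> D \<Longrightarrow> configuration (V i) (B i)"
    and nA: "normal_monoid (monoid_gen A)"
    and nB: "\<And>i. i \<in> D \<Longrightarrow> normal_monoid (monoid_gen (B i))"
  shows "normal_monoid (monoid_gen (nested_configuration A B))"
  unfolding normal_monoid_def
proof (intro ballI allI impI)
  \<comment> \<open>A \<open>good\<close> multiset \<open>Z\<close> presents the element
    \<open>total Z\<close> of the nested monoid; \<open>part Z i\<close> collects its summands from
    \<open>B i\<close>.\<close>
  define good where "good Z \<longleftrightarrow> index_sum Z \<in> monoid_gen A \<and> (\<forall>z\<in>#Z. snd z \<in> B (fst z))"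
    for Z :: "('t \<times> ('v \<Rightarrow>\<^sub>0 nat)) multiset"
  define part where "part Z i = image_mset snd (filter_mset (\<lambda>z. fst z = i) Z)"
    for Z :: "('t \<times> ('v \<Rightarrow>\<^sub>0 nat)) multiset" and i
  define total where "total Z = \<Sum>\<^sub># (image_mset snd Z)"
    for Z :: "('t \<times> ('v \<Rightarrow>\<^sub>0 nat)) multiset"
  have keysA: "Poly_Mapping.keys a \<subseteq> D" if "a \<in> monoid_gen A" for a
  proof -
    obtain M where "set_mset M \<subseteq> A" "a = \<Sum>\<^sub># M" using \<open>a \<in> monoid_gen A\<close> by (rule monoid_genE)
    moreover from this(1) have "Poly_Mapping.keys (\<Sum>\<^sub># M) \<subseteq> D"
    proof (induction M)
      case (add b M)
      with D(2)[of b] keys_add[of b "\<Sum>\<^sub># M"] show ?case by auto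
    qed simp
    ultimately show ?thesis by simp
  qed
  have size_part: "size (part Z i) = Poly_Mapping.lookup (index_sum Z) i" for Z i
    unfolding lookup_index_sum part_def by (induction Z) auto
  have part_B: "set_mset (part Z i) \<subseteq> B i" if "good Z" for Z i
    using that by (auto simp: part_def good_def)
  have keysB: "Poly_Mapping.keys (\<Sum>\<^sub># M) \<subseteq> V i" if "i \<in> D" "set_mset M \<subseteq> B i" for M i
    using that(2)
  proof (induction M)
    case (add b M)
    have "Poly_Mapping.keys b \<subseteq> V i" using B[OF that(1)] add.prems by (simp add: configuration_def)
    with add keys_add[of b "\<Sum>\<^sub># M"] show ?case by auto
  qed simp
  have total_part: "total Z = (\<Sum>i\<in>D. \<Sum>\<^sub># (part Z i))" if "good Z" for Z
  proof -
    have "fst z \<in> D" if "z \<in># Z" for z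
    proof -
      have "fst z \<in># image_mset fst Z" using that by simp
      then have "fst z \<in> Poly_Mapping.keys (index_sum Z)"
        by (simp only: in_keys_iff lookup_index_sum) simp
      then show ?thesis using keysA \<open>good Z\<close> by (auto simp: good_def)
    qed
    then show ?thesis
    proof (induction Z)
      case (add z Z)
      have "(\<Sum>i\<in>D. \<Sum>\<^sub># (part (add_mset z Z) i)) =
          (\<Sum>i\<in>D. (if fst z = i then snd z else 0) + \<Sum>\<^sub># (part Z i))"
        by (intro sum.cong) (auto simp: part_def)
      also have "\<dots> = snd z + total Z"
        using add D(1) by (simp add: sum.distrib sum.delta)
      finally show ?case by (simp add: total_def)
    qed (simp add: total_def part_def)
  qed
  \<comment> \<open>The variable sets are disjoint, so only block \<open>i\<close> contributes to
    the exponent of a variable in \<open>V i\<close>.\<close>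
  have lookup_total: "Poly_Mapping.lookup (total Z) v = Poly_Mapping.lookup (\<Sum>\<^sub># (part Z i)) v"
    if "good Z" "i \<in> D" "v \<in> V i" for Z i v
  proof -
    have "Poly_Mapping.lookup (\<Sum>\<^sub># (part Z j)) v = 0" if "j \<in> D - {i}" for j
    proof -
      have "v \<notin> V j" using V that \<open>i \<in> D\<close> \<open>v \<in> V i\<close> unfolding disjoint_family_on_def by blast
      then have "v \<notin> Poly_Mapping.keys (\<Sum>\<^sub># (part Z j))"
        using keysB[OF _ part_B[OF \<open>good Z\<close>], of j] that by blast
      then show ?thesis by (simp add: in_keys_iff)
    qed
    then show ?thesis
      unfolding total_part[OF that(1)] lookup_sum using that(2) D(1) by (simp add: sum.remove)
  qed

  fix x y z :: "'v \<Rightarrow>\<^sub>0 nat" and k :: nat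
  assume xyz: "x \<in> monoid_gen (nested_configuration A B)"
    "y \<in> monoid_gen (nested_configuration A B)" "z \<in> monoid_gen (nested_configuration A B)"
    and k: "k > 0" "nmul k x = nmul k y + z"
  then obtain X Y Z where XYZ: "x = total X" "good X" "y = total Y" "good Y" "z = total Z" "good Z"
    unfolding monoid_gen_nested_configuration good_def total_def by blast
  have parts: "nmul k (\<Sum>\<^sub># (part X i)) = nmul k (\<Sum>\<^sub># (part Y i)) + \<Sum>\<^sub># (part Z i)"
    if "i \<in> D" for i
  proof (rule poly_mapping_eqI)
    fix v
    show "Poly_Mapping.lookup (nmul k (\<Sum>\<^sub># (part X i))) v =
      Poly_Mapping.lookup (nmul k (\<Sum>\<^sub># (part Y i)) + \<Sum>\<^sub># (part Z i)) v"
    proof (cases "v \<in> V i")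
      case True
      show ?thesis
        using arg_cong[OF k(2), of "\<lambda>x. Poly_Mapping.lookup x v"] XYZ
        by (simp add: lookup_add lookup_total[OF _ that True])
    next
      case False
      then have "Poly_Mapping.lookup (\<Sum>\<^sub># (part W i)) v = 0" if "good W" for W
        using keysB[OF \<open>i \<in> D\<close> part_B[OF that]] by (auto simp: in_keys_iff)
      with XYZ show ?thesis by (simp add: lookup_add)
    qed
  qed
  have "\<forall>i\<in>D. \<exists>w. \<forall>b\<in>B i. (\<Sum>v\<in>V i. w v * real (Poly_Mapping.lookup b v)) = 1"
    using B by (simp add: configuration_def)
  then have "\<exists>w. \<forall>i\<in>D. \<forall>b\<in>B i. (\<Sum>v\<in>V i. w i v * real (Poly_Mapping.lookup b v)) = 1"
    by (rule bchoice)
  then obtain w where w: "\<And>i b. i \<in> D \<Longrightarrow> b \<in> B i \<Longrightarrow> (\<Sum>v\<in>V i. w i v * real (Poly_Mapping.lookup b v)) = 1"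
    by blast
  define wt where "wt i x = (\<Sum>v\<in>V i. w i v * real (Poly_Mapping.lookup x v))" for i x
  have wt_add: "wt i (x + y) = wt i x + wt i y" for i x y
    by (simp add: wt_def lookup_add algebra_simps sum.distrib)
  have wt_nmul: "wt i (nmul k x) = real k * wt i x" for i k x
    by (simp add: wt_def sum_distrib_left mult_ac)
  \<comment> \<open>Each element of \<open>B i\<close> has weight 1, so the number of summands
    depends only on the sum and not on the chosen presentation.\<close>
  have size_wt: "wt i (\<Sum>\<^sub># M) = real (size M)" if "i \<in> D" "set_mset M \<subseteq> B i" for M i
    using that(2)
  proof (induction M)
    case (add b M)
    then have "wt i b = 1" using w that(1) by (simp add: wt_def)
    with add show ?case by (simp add: wt_add)
  qed (simp add: wt_def)
  have "nmul k (index_sum X) = nmul k (index_sum Y) + index_sum Z"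
  proof (rule poly_mapping_eqI)
    fix i
    show "Poly_Mapping.lookup (nmul k (index_sum X)) i =
      Poly_Mapping.lookup (nmul k (index_sum Y) + index_sum Z) i"
    proof (cases "i \<in> D")
      case True
      have "real k * real (size (part X i)) = real k * real (size (part Y i)) + real (size (part Z i))"
        using arg_cong[OF parts[OF True], of "wt i"] size_wt[OF True] part_B XYZ
        by (simp add: wt_add wt_nmul)
      then have "k * size (part X i) = k * size (part Y i) + size (part Z i)"
        by (simp flip: of_nat_mult of_nat_add)
      then show ?thesis by (simp only: lookup_nmul lookup_add size_part)
    next
      case False
      then have "Poly_Mapping.lookup (index_sum W) i = 0" if "good W" for W
        using keysA[of "index_sum W"] that by (auto simp: good_def in_keys_iff)
      with XYZ show ?thesis by (simp add: lookup_add)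
    qed
  qed
  then obtain a where a: "a \<in> monoid_gen A" "index_sum X = index_sum Y + a"
    using normal_monoidD[OF nA _ _ _ k(1)] XYZ unfolding good_def by blast

  have "\<exists>N. set_mset N \<subseteq> B i \<and> \<Sum>\<^sub># (part X i) = \<Sum>\<^sub># (part Y i) + \<Sum>\<^sub># N" if "i \<in> D" for i
  proof -
    have "\<Sum>\<^sub># (part W i) \<in> monoid_gen (B i)" if "good W" for W
      using part_B[OF that] by (rule monoid_genI)
    then obtain e where "e \<in> monoid_gen (B i)" "\<Sum>\<^sub># (part X i) = \<Sum>\<^sub># (part Y i) + e"
      using normal_monoidD[OF nB[OF \<open>i \<in> D\<close>] _ _ _ k(1) parts[OF \<open>i \<in> D\<close>]] XYZ by blast
    then show ?thesis by (auto elim!: monoid_genE)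
  qed
  then obtain N where N: "\<And>i. i \<in> D \<Longrightarrow> set_mset (N i) \<subseteq> B i"
    "\<And>i. i \<in> D \<Longrightarrow> \<Sum>\<^sub># (part X i) = \<Sum>\<^sub># (part Y i) + \<Sum>\<^sub># (N i)"
    by metis
  \<comment> \<open>Tagging the elements of \<open>N i\<close> with \<open>i\<close> makes
    \<open>N i\<close> the \<open>i\<close>-th part of \<open>W\<close>, which is to present
    \<open>x - y\<close>.\<close>
  define W where "W = (\<Sum>i\<in>D. image_mset (Pair i) (N i))"
  have part_W: "part W i = N i" if "i \<in> D" for i
  proof -
    have "part (\<Sum>j\<in>E. image_mset (Pair j) (N j)) i = (if i \<in> E then N i else {#})" if "finite E" for E
      using that
      by (induction E rule: finite_induct)
         (auto simp: part_def filter_mset_image_mset image_mset.compositionality comp_def)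
    then show ?thesis using D(1) that by (simp add: W_def)
  qed
  have W_in: "fst z \<in> D \<and> snd z \<in> B (fst z)" if "z \<in># W" for z
    using that D(1) N(1)[THEN subsetD] by (auto simp: W_def set_mset_sum)
  \<comment> \<open>By weights, \<open>N i\<close> has as many elements as \<open>part X i\<close>
    has more than \<open>part Y i\<close>, and this excess is the \<open>i\<close>-th entry of
    \<open>a\<close>.\<close>
  have "index_sum W = a"
  proof (rule poly_mapping_eqI)
    fix i
    show "Poly_Mapping.lookup (index_sum W) i = Poly_Mapping.lookup a i"
    proof (cases "i \<in> D")
      case True
      have "real (size (part X i)) = real (size (part Y i)) + real (size (N i))"
        using arg_cong[OF N(2)[OF True], of "wt i"] size_wt[OF True] part_B XYZ N(1)[OF True]
        by (simp add: wt_add)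
      moreover have "size (part X i) = size (part Y i) + Poly_Mapping.lookup a i"
        unfolding size_part a(2) by (simp only: lookup_add)
      ultimately show ?thesis
        using part_W[OF True] size_part[of W i] by simp
    next
      case False
      then have "i \<notin># image_mset fst W" using W_in by auto
      then have "Poly_Mapping.lookup (index_sum W) i = 0"
        by (simp only: lookup_index_sum not_in_iff)
      moreover have "Poly_Mapping.lookup a i = 0"
        using False keysA[OF a(1)] by (auto simp: in_keys_iff)
      ultimately show ?thesis by simp
    qed
  qed
  with a(1) W_in have W: "good W" by (simp add: good_def)
  then have "total W \<in> monoid_gen (nested_configuration A B)"
    unfolding monoid_gen_nested_configuration good_def total_def by blast
  moreover have "x = y + total W"
    using XYZ W by (simp add: total_part N(2) part_W sum.distrib)
  ultimately show "\<exists>e\<in>monoid_gen (nested_configuration A B). x = y + e" by blast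
qed

theorem theorem1p2:
  fixes d r :: nat
    and \<mu> :: "nat \<Rightarrow> nat"
    and A :: "(nat \<Rightarrow>\<^sub>0 nat) set"
    and B :: "nat \<Rightarrow> (nat \<times> nat \<Rightarrow>\<^sub>0 nat) set"
  assumes "configuration {1..d} A"
    and "\<forall>a\<in>A. total_degree a = r"
    and "\<forall>i\<in>{1..d}. \<exists>a\<in>A. Poly_Mapping.lookup a i > 0"
    and "\<forall>i\<in>{1..d}. configuration ({i} \<times> {1..\<mu> i}) (B i)"
    and "normal_ring (toric_ring A :: ((nat \<Rightarrow>\<^sub>0 nat) \<Rightarrow>\<^sub>0 'k::field) set)"
    and "\<forall>i\<in>{1..d}. normal_ring (toric_ring (B i) :: ((nat \<times> nat \<Rightarrow>\<^sub>0 nat) \<Rightarrow>\<^sub>0 'k) set)"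
  shows "normal_ring (toric_ring (nested_configuration A B)
           :: ((nat \<times> nat \<Rightarrow>\<^sub>0 nat) \<Rightarrow>\<^sub>0 'k) set)"
proof (rule normal_ring_if_normal_monoid)
  have keys: "Poly_Mapping.keys a \<subseteq> {1..d}" if "a \<in> A" for a
    using assms(1) that unfolding configuration_def by blast
  have fin: "finite A" "\<And>i. i \<in> {1..d} \<Longrightarrow> finite (B i)"
    using assms(1,4) unfolding configuration_def by blast+
  show "finite (nested_configuration A B)"
    by (rule finite_nested_configuration[OF fin(1) keys finite_atLeastAtMost fin(2)])
  show "normal_monoid (monoid_gen (nested_configuration A B))"
  proof (rule normal_monoid_nested_configuration)
    \<comment> \<open>The first component of a variable names its block, which keeps the blocks
      disjoint.\<close>
    show "disjoint_family_on (\<lambda>i. {i} \<times> {1..\<mu> i}) {1..d}"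
      by (auto simp: disjoint_family_on_def)
    show "normal_monoid (monoid_gen A)"
      using assms(5) by (rule normal_monoid_if_normal_ring)
    show "normal_monoid (monoid_gen (B i))" if "i \<in> {1..d}" for i
      using bspec[OF assms(6) that] by (rule normal_monoid_if_normal_ring)
    show "configuration ({i} \<times> {1..\<mu> i}) (B i)" if "i \<in> {1..d}" for i
      using assms(4) that by (rule bspec)
  qed (use keys in \<open>simp_all\<close>)
qed

end
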